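(* Let $\Omega\subseteq\mathbb{R}^d$ and $\Omega'\subseteq\mathbb{R}^s$ be Borel sets and fix $\mu\in\mathbb{P}^p(\Omega)$ for some $p\ge 1$. For any $q\ge p$ and any $F,G\in L^q_\mu(\Omega;\Omega')$ it holds that $$W_p(F_\sharp\mu,G_\sharp\mu)\le\|F-G\|_{L^q_\mu(\Omega;\Omega')}.$$
   Context: $\mathbb{P}^p(\Omega)$ is the set of Borel probability measures on $\Omega$ with finite $p$-th moment. $F_\sharp\mu(A)=\mu(F^{-1}(A))$ is the pushforward. $\|f\|_{L^q_\mu(\Omega;\Omega')}=(\int_\Omega|f|^q\,d\mu)^{1/q}$ with $|\cdot|$ the Euclidean norm. The Wasserstein-$p$ distance between $\mu_1,\mu_2\in\mathbb{P}^p(\Omega')$ is $W_p(\mu_1,\mu_2)=\inf_{\pi\in\Gamma(\mu_1,\mu_2)}\big(\int_{\Omega'\times\Omega'}|x-y|^p\,d\pi(x,y)\big)^{1/p}$, where $\Gamma(\mu_1,\mu_2)$ is the set of Borel probability measures on $\Omega'\times\Omega'$ with marginals $\mu_1$ and $\mu_2$. *)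

theory Defs
  imports "HOL-Probability.Probability"
begin

abbreviation borel_on :: "'a::topological_space set \<Rightarrow> 'a measure" where
  "borel_on \<Omega> \<equiv> restrict_space borel \<Omega>"

(* All integrals below are nonnegative Lebesgue integrals with values in [0, \<infinity>]. The library
   has no real powers on ennreal; this is x to the power 1/p for p > 0. *)
definition ennreal_root :: "real \<Rightarrow> ennreal \<Rightarrow> ennreal" where
  "ennreal_root p x = (if x = \<infinity> then \<infinity> else ennreal (enn2real x powr (1 / p)))"

(* Equality of sigma-algebras includes equality of the carriers, so space M = \<Omega>. *)
definition prob_moment :: "real \<Rightarrow> 'a::euclidean_space set \<Rightarrow> 'a measure set" where
  "prob_moment p \<Omega> =
     {M. prob_space M \<and> sets M = sets (borel_on \<Omega>) \<and> (\<integral>\<^sup>+ x. ennreal (norm x powr p) \<partial>M) < \<infinity>}"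

definition pushforward ::
  "'b::topological_space set \<Rightarrow> ('a \<Rightarrow> 'b) \<Rightarrow> 'a measure \<Rightarrow> 'b measure" where
  "pushforward \<Omega>' F M = distr M (borel_on \<Omega>') F"

definition Lq_norm :: "real \<Rightarrow> 'a measure \<Rightarrow> ('a \<Rightarrow> 'b::euclidean_space) \<Rightarrow> ennreal" where
  "Lq_norm q M f = ennreal_root q (\<integral>\<^sup>+ x. ennreal (norm (f x) powr q) \<partial>M)"

(* Functions themselves rather than classes modulo equality almost everywhere; values outside
   space M are irrelevant. *)
definition Lq_space ::
  "real \<Rightarrow> 'a measure \<Rightarrow> 'b::euclidean_space set \<Rightarrow> ('a \<Rightarrow> 'b) set" where
  "Lq_space q M \<Omega>' = {f \<in> measurable M (borel_on \<Omega>'). Lq_norm q M f < \<infinity>}"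

definition couplings ::
  "'a::euclidean_space set \<Rightarrow> 'a measure \<Rightarrow> 'a measure \<Rightarrow> ('a \<times> 'a) measure set" where
  "couplings \<Omega> \<mu>\<^sub>1 \<mu>\<^sub>2 =
     {\<pi>. prob_space \<pi> \<and> sets \<pi> = sets (borel_on (\<Omega> \<times> \<Omega>)) \<and>
         distr \<pi> (borel_on \<Omega>) fst = \<mu>\<^sub>1 \<and> distr \<pi> (borel_on \<Omega>) snd = \<mu>\<^sub>2}"

definition wasserstein ::
  "real \<Rightarrow> 'a::euclidean_space set \<Rightarrow> 'a measure \<Rightarrow> 'a measure \<Rightarrow> ennreal" where
  "wasserstein p \<Omega> \<mu>\<^sub>1 \<mu>\<^sub>2 =
     (INF \<pi> \<in> couplings \<Omega> \<mu>\<^sub>1 \<mu>\<^sub>2.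
        ennreal_root p (\<integral>\<^sup>+ z. ennreal (norm (fst z - snd z) powr p) \<partial>\<pi>))"

lemma ennreal_root_less_top_iff: "ennreal_root p x < \<infinity> \<longleftrightarrow> x < \<infinity>"
  by (auto simp: ennreal_root_def less_top)

(* The pushforwards lie in the domain on which the Wasserstein distance is considered. *)
lemma pushforward_in_prob_moment:
  fixes \<Omega> :: "'a::euclidean_space set" and \<Omega>' :: "'b::euclidean_space set"
  assumes "1 \<le> p" "p \<le> q" "\<mu> \<in> prob_moment p \<Omega>" "F \<in> Lq_space q \<mu> \<Omega>'"
  shows "pushforward \<Omega>' F \<mu> \<in> prob_moment p \<Omega>'"
proof -
  interpret prob_space \<mu> using assms(3) by (simp add: prob_moment_def)
  have F: "F \<in> measurable \<mu> (borel_on \<Omega>')"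
    and fin: "(\<integral>\<^sup>+ x. ennreal (norm (F x) powr q) \<partial>\<mu>) < \<infinity>"
    using assms(4) unfolding Lq_space_def Lq_norm_def ennreal_root_less_top_iff by blast+
  have F'[measurable]: "F \<in> borel_measurable \<mu>"
    using F by (simp add: measurable_restrict_space2_iff)
  have le: "t powr p \<le> 1 + t powr q" if "t \<ge> 0" for t :: real
  proof (cases "t \<le> 1")
    case True
    then have "t powr p \<le> 1" using that assms(1) by (simp add: powr_le1)
    then show ?thesis by (simp add: add_increasing2)
  next
    case False
    then have "t powr p \<le> t powr q" using assms(2) by (simp add: powr_mono)
    then show ?thesis by simp
  qed
  have meas: "(\<lambda>x. ennreal (norm x powr p)) \<in> borel_measurable (borel_on \<Omega>')"
    by (rule measurable_restrict_space1) measurable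
  have "(\<integral>\<^sup>+ x. ennreal (norm x powr p) \<partial>pushforward \<Omega>' F \<mu>)
      = (\<integral>\<^sup>+ x. ennreal (norm (F x) powr p) \<partial>\<mu>)"
    unfolding pushforward_def by (rule nn_integral_distr[OF F]) (use meas in simp)
  also have "\<dots> \<le> (\<integral>\<^sup>+ x. 1 + ennreal (norm (F x) powr q) \<partial>\<mu>)"
    by (intro nn_integral_mono)
       (metis ennreal_1 ennreal_leI ennreal_plus le norm_ge_zero powr_ge_zero zero_le_one)
  also have "\<dots> = 1 + (\<integral>\<^sup>+ x. ennreal (norm (F x) powr q) \<partial>\<mu>)"
    by (subst nn_integral_add) (auto simp: emeasure_space_1)
  also have "\<dots> < \<infinity>" using fin by (simp add: less_top)
  finally show ?thesis
    using prob_space_distr[OF F] by (simp add: prob_moment_def pushforward_def)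
qed

end

theory Submission
  imports Defs
begin

text \<open>Evaluating \<open>F\<close> and \<open>G\<close> at the same \<open>\<mu>\<close>-random point transports one pushforward to the
  other: the law of \<open>x \<mapsto> (F x, G x)\<close> is a coupling whose cost has as \<open>p\<close>-th root the
  \<open>L\<^sup>p\<close> norm of \<open>F - G\<close>, and the Wasserstein distance is an infimum over
  couplings (\<open>wasserstein_pushforward_le\<close>). Since \<open>\<mu>\<close> has total mass one, \<open>L\<^sup>p\<close> norms increase
  with the exponent (\<open>Lq_norm_mono_exponent\<close>), so the \<open>L\<^sup>q\<close> norm is a bound as well.

  Monotonicity in the exponent is obtained by integrating a pointwise Young inequality
  (\<open>powr_le_Young\<close>), homogenised by a constant \<open>c\<close> that is then set to the \<open>L\<^sup>q\<close> norm itself.\<close>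

lemma ennreal_root_ennreal:
  "0 \<le> a \<Longrightarrow> ennreal_root p (ennreal a) = ennreal (a powr (1 / p))"
  by (simp add: ennreal_root_def)

text \<open>Weighted arithmetic-geometric mean of \<open>t powr q\<close> and \<open>c powr q\<close> with weights \<open>p / q\<close> and
  \<open>1 - p / q\<close>. The right-hand side is affine in \<open>t powr q\<close>, hence can be integrated against a
  probability measure, and equality holds at \<open>t = c\<close>, so nothing is lost when \<open>c\<close> is the \<open>L\<^sup>q\<close>
  norm of a function with constant norm \<open>t\<close>.\<close>

lemma powr_le_Young:
  fixes p q c t :: real
  assumes "0 < p" "p \<le> q" "0 < c" "0 \<le> t"
  shows "t powr p * c powr (q - p) \<le> p / q * t powr q + (1 - p / q) * c powr q"
proof (cases "t = 0")
  case True
  with assms show ?thesis by simp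
next
  case False
  have "(t powr q) powr (p / q) * (c powr q) powr (1 - p / q)
      \<le> p / q * t powr q + (1 - p / q) * c powr q"
    using assms False by (intro Youngs_inequality_0) auto
  moreover have "q * (1 - p / q) = q - p"
    using assms by (simp add: field_simps)
  ultimately show ?thesis
    using assms by (simp add: powr_powr)
qed

text \<open>With \<open>c\<close> the \<open>L\<^sup>q\<close> norm, integrating Young's inequality gives
  \<open>c powr (q - p) * (\<integral> norm (f x) powr p) \<le> c powr q\<close>, because the constant term integrates to
  itself over a space of mass one. The factor \<open>c powr (q - p)\<close> cancels only if \<open>c\<close> is positive and
  finite; otherwise \<open>f\<close> vanishes almost everywhere or the right-hand norm is infinite.\<close>

lemma (in prob_space) Lq_norm_mono_exponent:
  fixes f :: "'a \<Rightarrow> 'b::euclidean_space"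
  assumes f [measurable]: "f \<in> borel_measurable M" and p: "0 < p" "p \<le> q"
  shows "Lq_norm p M f \<le> Lq_norm q M f"
proof -
  define I where "I = (\<lambda>r. \<integral>\<^sup>+ x. ennreal (norm (f x) powr r) \<partial>M)"
  have "ennreal_root p (I p) \<le> ennreal_root q (I q)"
  proof (cases "I q")
    case top
    then show ?thesis by (simp add: ennreal_root_def)
  next
    case (real A)
    show ?thesis
    proof (cases "A = 0")
      case True
      then have "AE x in M. norm (f x) powr q = 0"
        using real by (simp add: I_def nn_integral_0_iff_AE ennreal_eq_0_iff antisym_conv)
      then have "AE x in M. ennreal (norm (f x) powr p) = 0"
        by eventually_elim simp
      then have "I p = 0"
        by (simp add: I_def nn_integral_0_iff_AE)
      then show ?thesis by (simp add: ennreal_root_def)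
    next
      case False
      define c where "c = A powr (1 / q)"
      have c: "0 < c" "c powr q = A"
        using False real p by (auto simp: c_def powr_powr)
      have "I p * ennreal (c powr (q - p))
          = (\<integral>\<^sup>+ x. ennreal (norm (f x) powr p * c powr (q - p)) \<partial>M)"
        by (simp add: I_def ennreal_mult nn_integral_multc)
      also have "\<dots> \<le> (\<integral>\<^sup>+ x. ennreal (p / q) * ennreal (norm (f x) powr q)
                          + ennreal ((1 - p / q) * c powr q) \<partial>M)"
      proof (rule nn_integral_mono)
        fix x
        have "ennreal (norm (f x) powr p * c powr (q - p))
            \<le> ennreal (p / q * norm (f x) powr q + (1 - p / q) * c powr q)"
          using p c by (intro ennreal_leI powr_le_Young) auto
        also have "\<dots> = ennreal (p / q) * ennreal (norm (f x) powr q)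
            + ennreal ((1 - p / q) * c powr q)"
          using p by (simp flip: ennreal_plus ennreal_mult)
        finally show "ennreal (norm (f x) powr p * c powr (q - p))
            \<le> ennreal (p / q) * ennreal (norm (f x) powr q)
              + ennreal ((1 - p / q) * c powr q)" .
      qed
      also have "\<dots> = ennreal (p / q) * I q + ennreal ((1 - p / q) * c powr q)"
        by (simp add: I_def nn_integral_add nn_integral_cmult emeasure_space_1)
      also have "\<dots> = ennreal (p / q * A + (1 - p / q) * A)"
        using p real c by (simp flip: ennreal_plus ennreal_mult)
      also have "p / q * A + (1 - p / q) * A = c powr p * c powr (q - p)"
        using c by (simp add: algebra_simps flip: powr_add)
      finally have le: "I p * ennreal (c powr (q - p)) \<le> ennreal (c powr p) * ennreal (c powr (q - p))"
        by (simp add: ennreal_mult)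
      have "I p \<le> ennreal (c powr p)"
        using le c by (simp add: ennreal_mult_le_mult_iff mult.commute[of _ "ennreal (c powr (q - p))"])
      then obtain B where B: "I p = ennreal B" "0 \<le> B" "B \<le> c powr p"
        by (cases "I p") (auto simp: top_unique)
      have "B powr (1 / p) \<le> (c powr p) powr (1 / p)"
        using B p by (intro powr_mono2) auto
      then show ?thesis
        using B p c real by (simp add: ennreal_root_ennreal powr_powr ennreal_leI flip: c_def)
    qed
  qed
  then show ?thesis by (simp add: Lq_norm_def I_def)
qed

text \<open>Second countability makes rectangles generate the Borel sets of the product space, so
  that pairing is Borel measurable.\<close>

lemma measurable_Pair_restrict_space_borel:
  fixes A :: "'b::second_countable_topology set" and B :: "'c::second_countable_topology set"
  assumes "f \<in> measurable M (borel_on A)" "g \<in> measurable M (borel_on B)"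
  shows "(\<lambda>x. (f x, g x)) \<in> measurable M (borel_on (A \<times> B))"
  using assms by (auto simp: measurable_restrict_space2_iff intro!: borel_measurable_Pair)

lemma measurable_fst_restrict_space_borel:
  fixes A :: "'b::topological_space set" and B :: "'c::topological_space set"
  shows "fst \<in> measurable (borel_on (A \<times> B)) (borel_on A)"
  by (auto simp: measurable_restrict_space2_iff space_restrict_space
      intro!: measurable_restrict_space1 borel_measurable_continuous_onI continuous_intros)

lemma measurable_snd_restrict_space_borel:
  fixes A :: "'b::topological_space set" and B :: "'c::topological_space set"
  shows "snd \<in> measurable (borel_on (A \<times> B)) (borel_on B)"
  by (auto simp: measurable_restrict_space2_iff space_restrict_space
      intro!: measurable_restrict_space1 borel_measurable_continuous_onI continuous_intros)

text \<open>Projecting the joint law of \<open>(F, G)\<close> undoes the pairing, so its marginals are the laws of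
  \<open>F\<close> and of \<open>G\<close>.\<close>

lemma pushforward_Pair_in_couplings:
  fixes \<Omega> :: "'b::euclidean_space set"
  assumes "prob_space M" and F: "F \<in> measurable M (borel_on \<Omega>)"
    and G: "G \<in> measurable M (borel_on \<Omega>)"
  shows "pushforward (\<Omega> \<times> \<Omega>) (\<lambda>x. (F x, G x)) M
    \<in> couplings \<Omega> (pushforward \<Omega> F M) (pushforward \<Omega> G M)"
proof -
  note FG = measurable_Pair_restrict_space_borel[OF F G]
  have "prob_space (distr M (borel_on (\<Omega> \<times> \<Omega>)) (\<lambda>x. (F x, G x)))"
    using assms(1) FG by (rule prob_space.prob_space_distr)
  then show ?thesis
    by (simp add: couplings_def pushforward_def distr_distr[OF _ FG] comp_def
        measurable_fst_restrict_space_borel measurable_snd_restrict_space_borel)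
qed

text \<open>By change of variables the joint law of \<open>(F, G)\<close> has transport cost
  \<open>\<integral> norm (F x - G x) powr p\<close>; its root bounds the infimum over all couplings.\<close>

lemma wasserstein_pushforward_le:
  fixes \<Omega> :: "'b::euclidean_space set"
  assumes "prob_space M" and F: "F \<in> measurable M (borel_on \<Omega>)"
    and G: "G \<in> measurable M (borel_on \<Omega>)"
  shows "wasserstein p \<Omega> (pushforward \<Omega> F M) (pushforward \<Omega> G M)
    \<le> Lq_norm p M (\<lambda>x. F x - G x)"
proof -
  have cost: "(\<lambda>z. ennreal (norm (fst z - snd z) powr p)) \<in> borel_measurable (borel_on (\<Omega> \<times> \<Omega>))"
    by (intro measurable_restrict_space1) (measurable; simp add: borel_prod[symmetric])
  have "(\<integral>\<^sup>+ z. ennreal (norm (fst z - snd z) powr p)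
           \<partial>pushforward (\<Omega> \<times> \<Omega>) (\<lambda>x. (F x, G x)) M)
      = (\<integral>\<^sup>+ x. ennreal (norm (F x - G x) powr p) \<partial>M)"
    unfolding pushforward_def
    by (subst nn_integral_distr[OF measurable_Pair_restrict_space_borel[OF F G]])
       (use cost in simp_all)
  then show ?thesis
    unfolding wasserstein_def Lq_norm_def
    by (intro INF_lower2[OF pushforward_Pair_in_couplings[OF assms]]) simp
qed

theorem theorem3p1:
  fixes \<Omega> :: "(real ^ 'd) set" and \<Omega>' :: "(real ^ 's) set"
    and \<mu> :: "(real ^ 'd) measure" and p q :: real
    and F G :: "real ^ 'd \<Rightarrow> real ^ 's"
  assumes "\<Omega> \<in> sets borel" and "\<Omega>' \<in> sets borel"
    and "1 \<le> p" and "\<mu> \<in> prob_moment p \<Omega>"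
    and "p \<le> q"
    and "F \<in> Lq_space q \<mu> \<Omega>'" and "G \<in> Lq_space q \<mu> \<Omega>'"
  shows "wasserstein p \<Omega>' (pushforward \<Omega>' F \<mu>) (pushforward \<Omega>' G \<mu>)
           \<le> Lq_norm q \<mu> (\<lambda>x. F x - G x)"
proof -
  interpret prob_space \<mu>
    using assms(4) by (simp add: prob_moment_def)
  have F: "F \<in> measurable \<mu> (borel_on \<Omega>')" and G: "G \<in> measurable \<mu> (borel_on \<Omega>')"
    using assms(6,7) by (simp_all add: Lq_space_def)
  have "(\<lambda>x. F x - G x) \<in> borel_measurable \<mu>"
    using F G by (intro borel_measurable_diff) (simp_all add: measurable_restrict_space2_iff)
  then have "Lq_norm p \<mu> (\<lambda>x. F x - G x) \<le> Lq_norm q \<mu> (\<lambda>x. F x - G x)"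
    using assms(3,5) by (intro Lq_norm_mono_exponent) auto
  with wasserstein_pushforward_le[OF prob_space_axioms F G] show ?thesis
    by (rule order_trans)
qed

end
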